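(* Let $n\ge 0$ be an integer. Then (i) for all $k\ge0$, $s_{n+f_{2k}}\ne s_n$ if and only if $\Phi_k(n)\in\{\frac{f_{2k+1}}{2},\frac{f_{2k+1}}{2}-1\}$; (ii) for all $k\ge1$, $s_{n+f_{2k+1}}\ne s_n$ if and only if $\Phi_k(n)\in\{\frac{f_{2k+3}}{2},\frac{f_{2k+3}}{2}-1,\frac{f_{2k+3}}{2}+f_{2k},\frac{f_{2k+3}}{2}+f_{2k}-1\}$.
   Context: Let $\tau$ be the substitution on $\{0,1\}$ with $\tau(1)=101$, $\tau(0)=1$ (extended to words by concatenation), and let $\mathbf{s}=(s_j)_{j\ge 0}=\lim_{j\to\infty}\tau^j(1)$ be its fixed point beginning with $1$. Define $f_{2j}=|\tau^j(1)|$, $f_{2j+1}=|\tau^j(10)|$ ($|w|$ = length of $w$); equivalently $f_0=1$, $f_1=2$, $f_{2j+2}=f_{2j}+f_{2j+1}$, $f_{2j+3}=f_{2j}+f_{2j+2}$; the $f_{2j+1}$ are even. Every integer $n\ge0$ has a unique representation $n=\sum_{i\ge0}a_i(n)f_i$ with $a_i(n)\in\{0,1\}$, finitely many nonzero, $a_ia_{i+1}=0$ for all $i$, and $a_ia_{i+2}=0$ for all even $i$. For $k\ge0$ the truncated $f$-representation is $\Phi_k(n)=\sum_{i=0}^{2k+2}a_i(n)f_i$. *)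

theory Defs
  imports Complex_Main "HOL-Library.Z2"
begin

text \<open>The alphabet is the two-element type \<^typ>\<open>bit\<close>; finite words are lists over it.\<close>

definition tau_letter :: "bit \<Rightarrow> bit list" where
  "tau_letter c = (if c = 1 then [1, 0, 1] else [1])"

definition tau :: "bit list \<Rightarrow> bit list" where
  "tau w = concat (map tau_letter w)"

text \<open>The letter at position \<open>j\<close> of the limit of the words \<open>tau ^^ m\<close> applied to \<open>[1]\<close>: the
  value that the letter at position \<open>j\<close> of these words takes for all sufficiently large \<open>m\<close>.
  That such a value exists is \<open>s_eq_nth\<close> together with \<open>length_tau_funpow_ge\<close> below.\<close>

definition s :: "nat \<Rightarrow> bit" where
  "s j = (THE c. \<exists>M. \<forall>m\<ge>M. j < length ((tau ^^ m) [1]) \<and> (tau ^^ m) [1] ! j = c)"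

definition f :: "nat \<Rightarrow> nat" where
  "f i = (if even i then length ((tau ^^ (i div 2)) [1]) else length ((tau ^^ (i div 2)) [1, 0]))"

definition is_f_rep :: "(nat \<Rightarrow> nat) \<Rightarrow> nat \<Rightarrow> bool" where
  "is_f_rep a n \<longleftrightarrow>
     (\<forall>i. a i \<in> {0, 1}) \<and> finite {i. a i \<noteq> 0} \<and>
     (\<forall>i. a i * a (i + 1) = 0) \<and>
     (\<forall>i. even i \<longrightarrow> a i * a (i + 2) = 0) \<and>
     n = (\<Sum>i | a i \<noteq> 0. a i * f i)"

definition f_digit :: "nat \<Rightarrow> nat \<Rightarrow> nat" where
  "f_digit n = (THE a. is_f_rep a n)"

definition Phi :: "nat \<Rightarrow> nat \<Rightarrow> nat" where
  "Phi k n = (\<Sum>i=0..2 * k + 2. f_digit n i * f i)"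


lemma tau_append [simp]: "tau (u @ v) = tau u @ tau v"
  by (simp add: tau_def)

lemma tau_funpow_append: "(tau ^^ m) (u @ v) = (tau ^^ m) u @ (tau ^^ m) v"
  by (induction m) simp_all

lemma tau_funpow_Suc_1: "(tau ^^ Suc m) [1] = (tau ^^ m) [1] @ (tau ^^ m) [0] @ (tau ^^ m) [1]"
proof -
  have "(tau ^^ Suc m) [1] = (tau ^^ m) ([1] @ [0] @ [1])"
    by (simp add: funpow_swap1 tau_def tau_letter_def)
  then show ?thesis by (simp only: tau_funpow_append)
qed

lemma tau_funpow_Suc_0: "(tau ^^ Suc m) [0] = (tau ^^ m) [1]"
  by (simp add: funpow_swap1 tau_def tau_letter_def)

lemma length_tau_funpow_ge: "m < length ((tau ^^ m) [1])"
proof (induction m)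
  case (Suc m)
  then show ?case by (simp only: tau_funpow_Suc_1 length_append)
qed simp

lemma tau_funpow_nth_mono:
  assumes "m \<le> m'" "j < length ((tau ^^ m) [1])"
  shows "j < length ((tau ^^ m') [1]) \<and> (tau ^^ m') [1] ! j = (tau ^^ m) [1] ! j"
  using assms(1)
proof (induction m' rule: dec_induct)
  case (step i)
  then show ?case
    by (simp only: tau_funpow_Suc_1 length_append nth_append) simp
qed (use assms(2) in simp)

lemma s_eq_nth:
  assumes "j < length ((tau ^^ m) [1])"
  shows "s j = (tau ^^ m) [1] ! j"
  unfolding s_def
proof (rule the_equality)
  show "\<exists>M. \<forall>m'\<ge>M. j < length ((tau ^^ m') [1]) \<and> (tau ^^ m') [1] ! j = (tau ^^ m) [1] ! j"
    using tau_funpow_nth_mono assms by blast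
next
  fix c assume "\<exists>M. \<forall>m'\<ge>M. j < length ((tau ^^ m') [1]) \<and> (tau ^^ m') [1] ! j = c"
  then obtain M where "\<forall>m'\<ge>M. (tau ^^ m') [1] ! j = c" by blast
  then have "(tau ^^ max M m) [1] ! j = c" by simp
  then show "c = (tau ^^ m) [1] ! j"
    using tau_funpow_nth_mono[of m "max M m" j] assms by simp
qed

lemma f_0: "f 0 = 1" and f_1: "f 1 = 2"
  by (simp_all add: f_def)

lemma length_tau_funpow_10:
  "length ((tau ^^ m) [1, 0]) = length ((tau ^^ m) [1]) + length ((tau ^^ m) [0])"
  using tau_funpow_append[of m "[1]" "[0]"] by simp

lemma f_even_rec: "f (2 * j + 2) = f (2 * j) + f (2 * j + 1)"
proof -
  have "f (2 * j + 2) = length ((tau ^^ Suc j) [1])" by (simp add: f_def)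
  also have "\<dots> = f (2 * j) + f (2 * j + 1)"
    by (simp only: tau_funpow_Suc_1 length_append) (simp add: f_def length_tau_funpow_10)
  finally show ?thesis .
qed

lemma f_odd_rec: "f (2 * j + 3) = f (2 * j) + f (2 * j + 2)"
proof -
  have d: "(2 * j + 3) div 2 = Suc j" by simp
  have "f (2 * j + 3) = length ((tau ^^ Suc j) [1]) + length ((tau ^^ Suc j) [0])"
    unfolding f_def d by (simp only: length_tau_funpow_10) simp
  also have "\<dots> = f (2 * j) + f (2 * j + 2)"
    by (simp only: tau_funpow_Suc_0) (simp add: f_def)
  finally show ?thesis .
qed

lemma even_f_odd: "even (f (2 * j + 1))"
proof (induction j)
  case 0
  then show ?case using f_1 by simp
next
  case (Suc j)
  have "f (2 * Suc j + 1) = 2 * f (2 * j) + f (2 * j + 1)"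
    using f_odd_rec[of j] f_even_rec[of j] by (simp add: numeral_3_eq_3)
  then show ?case using Suc by simp
qed

text \<open>Hence \<open>f (2 * k + 1) div 2\<close> is exact; it is moreover positive, so that
  \<open>f (2 * k + 1) div 2 - 1\<close> is not truncated.\<close>

lemma f_odd_ge: "2 \<le> f (2 * j + 1)"
proof (induction j)
  case (Suc j)
  then show ?case using f_odd_rec[of j] f_even_rec[of j] by (simp add: numeral_3_eq_3)
qed (use f_1 in simp)

end

theory Submission
  imports Defs
begin

text \<open>Write \<open>A\<close> and \<open>B\<close> for the images of \<open>1\<close> and \<open>0\<close> under \<open>tau ^^ k\<close>. The words
  \<open>AB\<close> and \<open>BA\<close> differ exactly at the two adjacent positions \<open>f (2k+1) / 2 - 1\<close> and
  \<open>f (2k+1) / 2\<close>: the images of \<open>10\<close> and \<open>01\<close> under one more substitution are \<open>ABAA\<close> and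
  \<open>AABA\<close>. The truncated representation \<open>Phi k n\<close> is the offset of \<open>n\<close> inside the block
  \<open>ABA\<close> or \<open>ABAA\<close> that contains it when \<open>s\<close> is cut into the images of \<open>1\<close> and \<open>10\<close> under
  \<open>tau ^^ (k+1)\<close>, and both are followed by \<open>ABA\<close>. A shift by \<open>f (2k)\<close>, the length of \<open>A\<close>,
  therefore compares \<open>AB\<close> with \<open>BA\<close> and otherwise \<open>A\<close> with \<open>A\<close>. A shift by \<open>f (2k+1)\<close>, the
  length of \<open>AB\<close>, compares \<open>BA\<close> with \<open>AB\<close> in a block \<open>ABA\<close>, and \<open>BAA\<close> with \<open>AAB\<close> in a block
  \<open>ABAA\<close>.\<close>

section \<open>Representations\<close>

definition f_digits :: "(nat \<Rightarrow> nat) \<Rightarrow> bool" where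
  "f_digits a \<longleftrightarrow> (\<forall>i. a i \<in> {0, 1}) \<and> (\<forall>i. a i * a (i + 1) = 0) \<and>
     (\<forall>i. even i \<longrightarrow> a i * a (i + 2) = 0)"

definition f_sum :: "(nat \<Rightarrow> nat) \<Rightarrow> nat \<Rightarrow> nat" where
  "f_sum a i = (\<Sum>l<i. a l * f l)"

lemma f_sum_0 [simp]: "f_sum a 0 = 0"
  and f_sum_Suc [simp]: "f_sum a (Suc i) = f_sum a i + a i * f i"
  by (simp_all add: f_sum_def)

text \<open>Any cutoff \<open>J\<close> beyond the support gives the same partial sum. This turns
  uniqueness and existence into inductions on the cutoff, where only the local digit conditions
  matter.\<close>

lemma is_f_rep_iff:
  "is_f_rep a n \<longleftrightarrow> f_digits a \<and> (\<exists>J. (\<forall>l\<ge>J. a l = 0) \<and> n = f_sum a J)"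
proof -
  have sum: "(\<Sum>i | a i \<noteq> 0. a i * f i) = f_sum a J" if "\<forall>l\<ge>J. a l = 0" for J
  proof -
    have "{i. a i \<noteq> 0} \<subseteq> {..<J}"
      using that by (metis (mono_tags) lessThan_iff mem_Collect_eq not_less subsetI)
    then show ?thesis
      unfolding f_sum_def by (intro sum.mono_neutral_left) auto
  qed
  have fin: "finite {i. a i \<noteq> 0} \<longleftrightarrow> (\<exists>J. \<forall>l\<ge>J. a l = 0)"
    unfolding finite_nat_set_iff_bounded Ball_def mem_Collect_eq by (meson not_le)
  have "(\<exists>J. \<forall>l\<ge>J. a l = 0) \<and> n = (\<Sum>i | a i \<noteq> 0. a i * f i) \<longleftrightarrow>
      (\<exists>J. (\<forall>l\<ge>J. a l = 0) \<and> n = f_sum a J)"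
    using sum by auto
  then show ?thesis
    unfolding is_f_rep_def f_digits_def fin by blast
qed

lemma f_digitsD:
  assumes "f_digits a"
  shows "a i = 0 \<or> a i = 1" "a i = 0 \<or> a (i + 1) = 0" "even i \<Longrightarrow> a i = 0 \<or> a (i + 2) = 0"
proof -
  note d = assms[unfolded f_digits_def]
  show "a i = 0 \<or> a i = 1"
    using d[THEN conjunct1, rule_format, of i] by simp
  show "a i = 0 \<or> a (i + 1) = 0"
    using d[THEN conjunct2, THEN conjunct1, rule_format, of i] by simp
  show "even i \<Longrightarrow> a i = 0 \<or> a (i + 2) = 0"
    using d[THEN conjunct2, THEN conjunct2, rule_format, of i] by simp
qed

lemma f_digits_le_1: "f_digits a \<Longrightarrow> a i \<noteq> 0 \<Longrightarrow> a i = 1"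
  using f_digitsD(1)[of a i] by simp

lemma f_digits_odd: "f_digits a \<Longrightarrow> a (2 * j + 1) \<noteq> 0 \<Longrightarrow> a (2 * j) = 0"
  using f_digitsD(2)[of a "2 * j"] by simp

lemma f_digits_even:
  assumes "f_digits a" "a (2 * j + 2) \<noteq> 0"
  shows "a (2 * j + 1) = 0" "a (2 * j) = 0"
  using f_digitsD(2)[OF assms(1), of "2 * j + 1"] f_digitsD(3)[OF assms(1), of "2 * j"] assms(2)
  by simp_all

section \<open>Bounds on partial sums and uniqueness of representations\<close>

lemma f_pos: "0 < f i"
proof -
  have "0 < length ((tau ^^ (i div 2)) [1])"
    using length_tau_funpow_ge[of "i div 2"] by linarith
  then show ?thesis
    unfolding f_def length_tau_funpow_10 by simp
qed

lemma nat_cases_parity: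
  obtains "i = 0" | j where "i = 2 * j + 1" | j where "i = 2 * j + (2::nat)"
proof (cases "even i")
  case True
  then obtain m where m: "i = 2 * m" by blast
  then show ?thesis using that by (cases m) auto
next
  case False
  then show ?thesis using that(2) by (blast elim: oddE)
qed

lemma f_le_Suc: "f i \<le> f (Suc i)"
proof (cases i rule: nat_cases_parity)
  case 1
  then show ?thesis using f_0 f_1 by simp
next
  case (2 j)
  then show ?thesis using f_even_rec[of j] by simp
next
  case (3 j)
  then show ?thesis using f_odd_rec[of j] by (simp add: numeral_3_eq_3)
qed

text \<open>The digit conditions match the recurrences. A top digit at \<open>2j+1\<close> or
  \<open>2j+2\<close> forces all other digits from \<open>2j\<close> on to vanish, so what remains
  is below \<open>f (2j)\<close>, and adding \<open>f (2j)\<close> to the top term gives exactly the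
  next value of \<open>f\<close>.\<close>

lemma f_sum_less:
  assumes "f_digits a"
  shows "f_sum a i < f i"
proof (induction i rule: less_induct)
  case (less i)
  show ?case
  proof (cases i)
    case 0
    then show ?thesis by (simp add: f_pos)
  next
    case (Suc i')
    show ?thesis
    proof (cases "a i' = 0")
      case True
      then show ?thesis using less[of i'] f_le_Suc[of i'] Suc by simp
    next
      case False
      then have a1: "a i' = 1" by (rule f_digits_le_1[OF assms])
      show ?thesis
      proof (cases i' rule: nat_cases_parity)
        case 1
        then show ?thesis using a1 f_0 f_1 Suc by simp
      next
        case (2 j)
        then show ?thesis
          using a1 f_digits_odd[OF assms, of j] f_even_rec[of j] less[of "2 * j"] Suc by simp
      next
        case (3 j)
        then show ?thesis
          using a1 f_digits_even[OF assms, of j] f_odd_rec[of j] less[of "2 * j"] Suc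
          by (simp add: numeral_3_eq_3)
      qed
    qed
  qed
qed

text \<open>The top digits must agree: a top digit 1 contributes at least \<open>f J\<close>,
  whereas with top digit 0 the whole sum stays below \<open>f J\<close> by
  \<open>f_sum_less\<close>. Equal top terms then cancel.\<close>

lemma f_digits_inject:
  assumes "f_digits a" "f_digits b" "f_sum a J = f_sum b J" "l < J"
  shows "a l = b l"
  using assms(3,4)
proof (induction J)
  case (Suc J)
  have "a J = b J"
    using f_sum_less[OF assms(1), of J] f_sum_less[OF assms(2), of J] Suc.prems(1)
      f_digits_le_1[OF assms(1), of J] f_digits_le_1[OF assms(2), of J]
    by (cases "a J = 0"; cases "b J = 0") auto
  then show ?case using Suc by (cases "l = J") auto
qed simp

lemma f_sum_eq_beyond:
  assumes "\<forall>l\<ge>J. a l = 0" "J \<le> K"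
  shows "f_sum a K = f_sum a J"
  using assms(2) by (induction K rule: dec_induct) (use assms(1) in auto)

lemma is_f_rep_unique:
  assumes "is_f_rep a n" "is_f_rep b n"
  shows "a = b"
proof
  fix l
  obtain J where a: "f_digits a" "\<forall>l\<ge>J. a l = 0" "n = f_sum a J"
    using assms(1) is_f_rep_iff by auto
  obtain K where b: "f_digits b" "\<forall>l\<ge>K. b l = 0" "n = f_sum b K"
    using assms(2) is_f_rep_iff by auto
  define M where "M = Suc (max l (max J K))"
  have "f_sum a M = f_sum b M"
    using f_sum_eq_beyond[OF a(2), of M] f_sum_eq_beyond[OF b(2), of M] a(3) b(3)
    by (simp add: M_def)
  then show "a l = b l"
    by (rule f_digits_inject[OF a(1) b(1)]) (simp add: M_def)
qed

section \<open>Existence of representations\<close>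

lemma f_digits_upd:
  assumes "f_digits a" "\<forall>l\<ge>i. a l = 0"
    "\<And>l. Suc l = i \<Longrightarrow> a l = 0" "\<And>l. l + 2 = i \<Longrightarrow> even i \<Longrightarrow> a l = 0"
  shows "f_digits (a(i := 1))"
proof -
  let ?b = "a(i := 1)"
  have "?b l \<in> {0, 1}" for l
    using assms(1) by (simp add: f_digits_def)
  moreover have "?b l * ?b (l + 1) = 0" for l
  proof -
    have "a l * a (l + 1) = 0"
      using assms(1) by (simp add: f_digits_def)
    then show ?thesis using assms(2,3) by simp
  qed
  moreover have "?b l * ?b (l + 2) = 0" if "even l" for l
  proof -
    have "a l * a (l + 2) = 0"
      using assms(1) that by (simp add: f_digits_def)
    then show ?thesis using assms(2) assms(4)[of l] that by auto
  qed
  ultimately show ?thesis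
    unfolding f_digits_def by blast
qed

text \<open>Greedy choice: the term \<open>f i'\<close> just below the cutoff is subtracted whenever
  it fits. For positive \<open>i'\<close> the recurrence leaves a remainder below
  \<open>f (2j)\<close>, whose digits vanish wherever the new digit 1 forbids a neighbour.\<close>

lemma f_rep_exists:
  assumes "n < f i"
  shows "\<exists>a. f_digits a \<and> (\<forall>l\<ge>i. a l = 0) \<and> n = f_sum a i"
  using assms
proof (induction i arbitrary: n rule: less_induct)
  case (less i)
  have upd: "\<exists>a. f_digits a \<and> (\<forall>l\<ge>i. a l = 0) \<and> n = f_sum a i"
    if top: "f i' \<le> n" "n - f i' < f j" "i = Suc i'" "j < i'" "even i' \<Longrightarrow> Suc j < i'" for i' j
  proof -
    obtain a where a: "f_digits a" "\<forall>l\<ge>j. a l = 0" "n - f i' = f_sum a j"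
      using less.IH[OF _ top(2)] top(3,4) by auto
    have "f_sum (a(i' := 1)) i' = f_sum a i'"
      by (simp add: f_sum_def)
    then have "f_sum (a(i' := 1)) i = n"
      using f_sum_eq_beyond[OF a(2), of i'] a(3) top by simp
    moreover have "f_digits (a(i' := 1))"
    proof (rule f_digits_upd[OF a(1)])
      show "\<forall>l\<ge>i'. a l = 0"
        using a(2) top(4) by simp
      show "a l = 0" if "Suc l = i'" for l
        using a(2) top(4) that by simp
      show "a l = 0" if "l + 2 = i'" "even i'" for l
        using a(2) top(5) that by simp
    qed
    ultimately show ?thesis
      using a(2) top(3,4) by (intro exI[of _ "a(i' := 1)"]) simp
  qed
  show ?case
  proof (cases i)
    case 0
    then show ?thesis
      using less.prems f_0 by (intro exI[of _ "\<lambda>_. 0"]) (simp add: f_digits_def)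
  next
    case (Suc i')
    show ?thesis
    proof (cases "n < f i'")
      case True
      then obtain a where a: "f_digits a" "\<forall>l\<ge>i'. a l = 0" "n = f_sum a i'"
        using less.IH[of i' n] Suc by auto
      then show ?thesis
        using Suc by (intro exI[of _ a]) simp
    next
      case False
      then have le: "f i' \<le> n" by simp
      show ?thesis
      proof (cases i' rule: nat_cases_parity)
        case 1
        then have n: "n = 1" using le less.prems Suc f_0 f_1 by simp
        let ?a = "\<lambda>l. if l = 0 then 1 else 0 :: nat"
        have "f_digits ?a"
          by (simp add: f_digits_def)
        moreover have "n = f_sum ?a i"
          using n 1 Suc f_0 by simp
        ultimately show ?thesis
          using Suc by (intro exI[of _ ?a]) simp
      next
        case (2 j)
        show ?thesis
          by (rule upd[of i' "2 * j"]) (use 2 le Suc f_even_rec[of j] less.prems in simp_all)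
      next
        case (3 j)
        have "f i = f (2 * j) + f i'"
          using 3 Suc f_odd_rec[of j] by (simp add: numeral_3_eq_3)
        then show ?thesis
          by (intro upd[of i' "2 * j"]) (use 3 le Suc less.prems in simp_all)
      qed
    qed
  qed
qed

lemma less_f: "n < f (2 * n)"
  using length_tau_funpow_ge[of n] by (simp add: f_def)

lemma is_f_rep_f_digit: "is_f_rep (f_digit n) n"
proof -
  obtain a where "is_f_rep a n"
    using f_rep_exists[OF less_f] is_f_rep_iff by blast
  then show ?thesis
    unfolding f_digit_def by (metis (mono_tags) theI is_f_rep_unique)
qed

lemma Phi_eq_f_sum: "Phi k n = f_sum (f_digit n) (2 * k + 3)"
  unfolding Phi_def f_sum_def by (rule sum.cong) auto

section \<open>Blocks\<close>

abbreviation A :: "nat \<Rightarrow> bit list" where "A k \<equiv> (tau ^^ k) [1]"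
abbreviation B :: "nat \<Rightarrow> bit list" where "B k \<equiv> (tau ^^ k) [0]"

lemma length_A: "length (A k) = f (2 * k)"
  by (simp add: f_def)

lemma length_AB: "length (A k) + length (B k) = f (2 * k + 1)"
  by (simp add: f_def length_tau_funpow_10)

section \<open>Location of a position inside the blocks of \<open>s\<close>\<close>

definition reads :: "nat \<Rightarrow> bit list \<Rightarrow> bool" where
  "reads m w \<longleftrightarrow> (\<forall>i<length w. s (m + i) = w ! i)"

lemma reads_append: "reads m (u @ v) \<longleftrightarrow> reads m u \<and> reads (m + length u) v"
proof
  assume L: "reads m (u @ v)"
  have "s (m + length u + i) = v ! i" if "i < length v" for i
    using L[unfolded reads_def, rule_format, of "length u + i"] that by (simp add: add.assoc)
  moreover have "s (m + i) = u ! i" if "i < length u" for i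
    using L[unfolded reads_def, rule_format, of i] that by (simp add: nth_append)
  ultimately show "reads m u \<and> reads (m + length u) v"
    by (simp add: reads_def)
next
  assume R: "reads m u \<and> reads (m + length u) v"
  show "reads m (u @ v)"
    unfolding reads_def
  proof (intro allI impI)
    fix i assume "i < length (u @ v)"
    then show "s (m + i) = (u @ v) ! i"
      using R[unfolded reads_def, THEN conjunct1, rule_format, of i]
        R[unfolded reads_def, THEN conjunct2, rule_format, of "i - length u"]
      by (cases "i < length u") (auto simp: nth_append)
  qed
qed

text \<open>The alternatives are an image of \<open>10\<close> and one of \<open>1\<close>, with the beginning of the next
  block; the digit at \<open>2j\<close> selects the \<open>0\<close> of a \<open>10\<close>, so it vanishes in the second case.\<close>

lemma reads_block:
  assumes a: "f_digits a" "\<forall>l\<ge>2*J. a l = 0" and "j \<le> J"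
  shows "\<exists>m. f_sum a (2 * J) = m + f_sum a (2 * j + 1) \<and>
    (reads m (A j @ B j @ A j) \<or> a (2 * j) = 0 \<and> reads m (A j @ A j))"
  using \<open>j \<le> J\<close>
proof (induction j rule: inc_induct)
  case base
  \<comment> \<open>The induction descends from \<open>J\<close>, starting at the origin:
    \<open>s\<close> begins with \<open>A (Suc J)\<close>, which is \<open>ABA\<close> at level
    \<open>J\<close>, and the digit at \<open>2J\<close> is zero.\<close>
  have "reads 0 (A (Suc J))"
    by (simp add: reads_def s_eq_nth del: funpow.simps)
  then show ?case
    using a(2) by (simp only: tau_funpow_Suc_1) auto
next
  case (step j)
  then obtain m where m: "f_sum a (2 * J) = m + f_sum a (2 * Suc j + 1)"
    "reads m (A (Suc j) @ B (Suc j) @ A (Suc j)) \<or>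
      a (2 * Suc j) = 0 \<and> reads m (A (Suc j) @ A (Suc j))"
    by blast
  \<comment> \<open>The digits at \<open>2j+1\<close> and \<open>2j+2\<close> select the subblock.
    With both zero the start stays and \<open>ABA\<close> is read. A digit at \<open>2j+1\<close>
    skips \<open>AB\<close>, and one at \<open>2j+2\<close> skips \<open>ABA\<close>, possible only
    in the long block. After either skip \<open>AA\<close> is read, and the digit at
    \<open>2j\<close> is zero.\<close>
  define m' where "m' = m + a (2 * j + 1) * f (2 * j + 1) + a (2 * j + 2) * f (2 * j + 2)"
  have r: "reads m (A j @ B j @ A j @ A j @ A j @ B j @ A j) \<or>
      a (2 * j + 2) = 0 \<and> reads m (A j @ B j @ A j @ A j @ B j @ A j)"
    using m(2) by (simp only: tau_funpow_Suc_1 tau_funpow_Suc_0 append_assoc) simp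
  have "f_sum a (2 * J) = m' + f_sum a (2 * j + 1)"
    using m(1) by (simp add: m'_def)
  moreover have "reads m' (A j @ B j @ A j) \<or> a (2 * j) = 0 \<and> reads m' (A j @ A j)"
  proof (cases "a (2 * j + 2) = 0")
    case True
    show ?thesis
    proof (cases "a (2 * j + 1) = 0")
      case True
      then have "m' = m"
        using \<open>a (2 * j + 2) = 0\<close> by (simp add: m'_def)
      then show ?thesis using r by (auto simp: reads_append)
    next
      case False
      then have d: "a (2 * j + 1) = 1" "a (2 * j) = 0"
        using f_digits_le_1[OF a(1)] f_digits_odd[OF a(1)] by blast+
      have "m' = m + length (A j) + length (B j)"
        using True d length_AB[of j] by (simp add: m'_def)
      then show ?thesis using r d by (auto simp: reads_append)
    qed
  next
    case False
    then have z: "a (2 * j + 1) = 0" "a (2 * j) = 0" "a (2 * j + 2) = 1"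
      using f_digits_le_1[OF a(1)] f_digits_even[OF a(1)] by blast+
    have "m' = m + length (A j) + length (B j) + length (A j)"
      using z length_AB[of j] length_A[of j] f_even_rec[of j] by (simp add: m'_def)
    then show ?thesis using r z by (auto simp: reads_append)
  qed
  ultimately show ?case by blast
qed

lemma Phi_block:
  obtains m where "n = m + Phi k n" "Phi k n < f (2 * k + 3)"
      "reads m (A k @ B k @ A k @ A k @ A k @ B k @ A k)"
  | m where "n = m + Phi k n" "Phi k n < f (2 * k + 2)"
      "reads m (A k @ B k @ A k @ A k @ B k @ A k)"
proof -
  let ?a = "f_digit n"
  obtain J where a: "f_digits ?a" "\<forall>l\<ge>J. ?a l = 0" "n = f_sum ?a J"
    using is_f_rep_f_digit is_f_rep_iff by blast
  define K where "K = max J (Suc k)"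
  have "J \<le> K" "Suc k \<le> K"
    by (simp_all add: K_def)
  have K: "\<forall>l\<ge>2*K. ?a l = 0" "n = f_sum ?a (2 * K)"
    using a(2,3) f_sum_eq_beyond[OF a(2), of "2 * K"] \<open>J \<le> K\<close> by simp_all
  obtain m where m: "n = m + f_sum ?a (2 * Suc k + 1)"
    "reads m (A (Suc k) @ B (Suc k) @ A (Suc k)) \<or>
      ?a (2 * Suc k) = 0 \<and> reads m (A (Suc k) @ A (Suc k))"
    using reads_block[OF a(1) K(1), of "Suc k"] K(2) \<open>Suc k \<le> K\<close> by auto
  have phi: "Phi k n = f_sum ?a (2 * Suc k + 1)"
    by (simp add: Phi_eq_f_sum numeral_3_eq_3)
  from m(2) show ?thesis
  proof
    assume "reads m (A (Suc k) @ B (Suc k) @ A (Suc k))"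
    then show ?thesis
      using that(1)[of m] m(1) phi f_sum_less[OF a(1), of "2 * k + 3"]
      by (simp only: tau_funpow_Suc_1 tau_funpow_Suc_0 append_assoc) (simp add: Phi_eq_f_sum)
  next
    assume *: "?a (2 * Suc k) = 0 \<and> reads m (A (Suc k) @ A (Suc k))"
    \<comment> \<open>The zero digit at \<open>2k+2\<close> lowers the cutoff by one, which sharpens
      the bound to the length of the short block \<open>ABA\<close>.\<close>
    then have "Phi k n = f_sum ?a (2 * k + 2)"
      by (simp add: phi)
    then show ?thesis
      using that(2)[of m] m(1) phi * f_sum_less[OF a(1), of "2 * k + 2"]
      by (simp only: tau_funpow_Suc_1 append_assoc)
  qed
qed

section \<open>Comparison of words\<close>

lemma nth_append_mid_neq_iff:
  assumes "length v = length w" "i < length (u @ v @ x)"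
  shows "(u @ v @ x) ! i \<noteq> (u @ w @ x) ! i \<longleftrightarrow>
    length u \<le> i \<and> i < length u + length v \<and> v ! (i - length u) \<noteq> w ! (i - length u)"
  using assms by (auto simp: nth_append)

lemma f_odd_Suc_half: "f (2 * k + 3) div 2 = f (2 * k) + f (2 * k + 1) div 2"
  using f_odd_rec[of k] f_even_rec[of k] by simp

text \<open>One level up, the words are \<open>BA\<close> and \<open>AB\<close> between a common
  prefix \<open>A k\<close> and a common suffix \<open>A k\<close>. The pair of differing positions
  thus moves by \<open>f (2k)\<close>, which is also the growth of half the length.\<close>

lemma AB_neq_BA_iff:
  assumes "i < f (2 * k + 1)"
  shows "(A k @ B k) ! i \<noteq> (B k @ A k) ! i \<longleftrightarrow>
    i \<in> {f (2 * k + 1) div 2, f (2 * k + 1) div 2 - 1}"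
  using assms
proof (induction k arbitrary: i)
  case 0
  then show ?case using f_1 by (auto simp: less_Suc_eq numeral_2_eq_2)
next
  case (Suc k)
  let ?u = "A k" and ?v = "B k @ A k" and ?w = "A k @ B k"
  have len: "length (A (Suc k) @ B (Suc k)) = f (2 * Suc k + 1)"
    using length_AB[of "Suc k"] by simp
  have half: "f (2 * Suc k + 1) div 2 = f (2 * k) + f (2 * k + 1) div 2"
    using f_odd_Suc_half[of k] by (simp add: numeral_3_eq_3)
  have eq: "A (Suc k) @ B (Suc k) = ?u @ ?v @ A k" "B (Suc k) @ A (Suc k) = ?u @ ?w @ A k"
    by (simp_all only: tau_funpow_Suc_1 tau_funpow_Suc_0 append_assoc)
  have "(A (Suc k) @ B (Suc k)) ! i \<noteq> (B (Suc k) @ A (Suc k)) ! i \<longleftrightarrow>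
      length ?u \<le> i \<and> i < length ?u + length ?v \<and> ?v ! (i - length ?u) \<noteq> ?w ! (i - length ?u)"
    unfolding eq
  proof (rule nth_append_mid_neq_iff)
    show "i < length (?u @ ?v @ A k)"
      using Suc.prems by (simp only: eq(1)[symmetric] len)
  qed simp
  also have "\<dots> \<longleftrightarrow> f (2 * k) \<le> i \<and> i - f (2 * k) < f (2 * k + 1) \<and>
      i - f (2 * k) \<in> {f (2 * k + 1) div 2, f (2 * k + 1) div 2 - 1}"
    using Suc.IH[of "i - f (2 * k)"] length_A[of k] length_AB[of k] by auto
  \<comment> \<open>The half is at least 1, so subtracting 1 from it is not truncated and commutes
    with the shift by \<open>f (2k)\<close>.\<close>
  also have "\<dots> \<longleftrightarrow> i \<in> {f (2 * Suc k + 1) div 2, f (2 * Suc k + 1) div 2 - 1}"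
    unfolding half using f_odd_ge[of k] by auto
  finally show ?case .
qed

text \<open>Equivalently, \<open>B k\<close> is shorter than \<open>A k\<close>; at
  \<open>k = 0\<close> both have length 1.\<close>

lemma f_odd_less_double: "1 \<le> k \<Longrightarrow> f (2 * k + 1) < 2 * f (2 * k)"
proof -
  assume "1 \<le> k"
  then obtain j where "k = Suc j" by (cases k) auto
  then show ?thesis
    using f_odd_rec[of j] f_even_rec[of j] f_odd_ge[of j] by (simp add: numeral_3_eq_3)
qed

text \<open>Over two letters inequality is exclusive or, so along a chain of words the sets of
  differing positions combine by symmetric difference.\<close>

lemma bit_neq_trans_iff: "x \<noteq> z \<longleftrightarrow> (x \<noteq> y) \<noteq> (y \<noteq> (z :: bit))"
  by (cases x; cases y; cases z) simp_all

text \<open>For \<open>k = 0\<close> the two pairs of positions overlap.\<close>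

lemma BAA_neq_AAB_iff:
  assumes "1 \<le> k" "i < f (2 * k) + f (2 * k + 1)"
  shows "(B k @ A k @ A k) ! i \<noteq> (A k @ A k @ B k) ! i \<longleftrightarrow>
    i \<in> {f (2 * k + 1) div 2, f (2 * k + 1) div 2 - 1,
         f (2 * k) + f (2 * k + 1) div 2, f (2 * k) + f (2 * k + 1) div 2 - 1}"
    (is "?x \<noteq> ?z \<longleftrightarrow> _")
proof -
  \<comment> \<open>The intermediate word \<open>ABA\<close> splits the comparison into two swaps of
    adjacent factors, each governed by \<open>AB_neq_BA_iff\<close>. Since \<open>h < F\<close>, the
    two resulting pairs of positions are disjoint and their symmetric difference is their
    union.\<close>
  let ?y = "(A k @ B k @ A k) ! i"
  define F G h where "F = f (2 * k)" and "G = f (2 * k + 1)" and "h = G div 2"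
  have h: "1 \<le> h" "h < G" "h < F"
    using f_odd_ge[of k] f_odd_less_double[OF assms(1)] unfolding F_def G_def h_def by linarith+
  have len: "length (A k) = F" "length (A k) + length (B k) = G"
    using length_A[of k] length_AB[of k] by (simp_all add: F_def G_def)
  have AB: "(A k @ B k) ! l \<noteq> (B k @ A k) ! l \<longleftrightarrow> l \<in> {h, h - 1}" if "l < G" for l
    using AB_neq_BA_iff[of l k] that unfolding h_def G_def by blast
  have i: "i < F + G"
    using assms(2) by (simp add: F_def G_def)
  have "?x \<noteq> ?y \<longleftrightarrow> i < G \<and> (B k @ A k) ! i \<noteq> (A k @ B k) ! i"
    using nth_append_mid_neq_iff[of "B k @ A k" "A k @ B k" i "[]" "A k"] i len
    by (simp add: add.commute)
  also have "\<dots> \<longleftrightarrow> i \<in> {h, h - 1}"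
    using AB[of i] h by (cases "i < G") auto
  finally have xy: "?x \<noteq> ?y \<longleftrightarrow> \<dots>" .
  have "?y \<noteq> ?z \<longleftrightarrow> F \<le> i \<and> (B k @ A k) ! (i - F) \<noteq> (A k @ B k) ! (i - F)"
    using nth_append_mid_neq_iff[of "B k @ A k" "A k @ B k" i "A k" "[]"] i len
    by (simp add: add.commute)
  also have "\<dots> \<longleftrightarrow> F \<le> i \<and> i - F \<in> {h, h - 1}"
    using AB[of "i - F"] i by (cases "F \<le> i") (auto simp: less_diff_conv2)
  also have "\<dots> \<longleftrightarrow> i \<in> {F + h, F + h - 1}"
    using h by auto
  finally have yz: "?y \<noteq> ?z \<longleftrightarrow> \<dots>" .
  show ?thesis
    unfolding bit_neq_trans_iff[of ?x ?z ?y] xy yz F_def[symmetric] G_def[symmetric]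
      h_def[symmetric]
    using h by auto
qed

section \<open>Differences between \<open>s\<close> and its shifts\<close>

lemma reads_nth: "reads m w \<Longrightarrow> i < length w \<Longrightarrow> s (m + i) = w ! i"
  by (simp add: reads_def)

lemma reads_neq_iff:
  assumes "reads m w" "reads (m + d) w'" "length w = length w'" "i < length w"
  shows "s (m + i + d) \<noteq> s (m + i) \<longleftrightarrow> w ! i \<noteq> w' ! i"
proof -
  have "s (m + i + d) = w' ! i"
    using reads_nth[OF assms(2), of i] assms(3,4) by (simp add: ac_simps)
  moreover have "s (m + i) = w ! i"
    using reads_nth[OF assms(1,4)] .
  ultimately show ?thesis by auto
qed

lemma reads_eq:
  assumes "reads m w" "reads (m + d) w" "i < length w"
  shows "s (m + i + d) = s (m + i)"
  using reads_neq_iff[OF assms(1,2) refl assms(3)] by blast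

lemma shift_f_even:
  "s (n + f (2 * k)) \<noteq> s n \<longleftrightarrow> Phi k n \<in> {f (2 * k + 1) div 2, f (2 * k + 1) div 2 - 1}"
proof -
  define a b r where "a = length (A k)" and "b = length (B k)" and "r = Phi k n"
  have f: "f (2 * k) = a" "f (2 * k + 1) = a + b" "f (2 * k + 2) = a + a + b"
    "f (2 * k + 3) = a + a + a + b"
    using length_A[of k] length_AB[of k] f_even_rec[of k] f_odd_rec[of k]
    by (simp_all add: a_def b_def)
  have len: "length (A k) = a" "length (B k) = b"
    by (simp_all add: a_def b_def)
  \<comment> \<open>Both block types are merged: \<open>ABAA\<close> is read either way, and an
    offset beyond \<open>ABA\<close> occurs only in the long block, whose last \<open>A\<close> is
    followed by another \<open>A\<close>.\<close>
  obtain m where m: "n = m + r" "r < a + a + a + b" "reads m (A k @ B k @ A k @ A k)"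
    "r < a + a + b \<or> reads (m + (a + a + b)) (A k @ A k)"
  proof (cases n k rule: Phi_block)
    case (1 m)
    show ?thesis
    proof (rule that)
      show "n = m + r" "r < a + a + a + b"
        using 1 f by (simp_all add: r_def)
      show "reads m (A k @ B k @ A k @ A k)"
        "r < a + a + b \<or> reads (m + (a + a + b)) (A k @ A k)"
        using 1(3) by (simp_all add: reads_append len ac_simps)
    qed
  next
    case (2 m)
    show ?thesis
    proof (rule that)
      show "n = m + r" "r < a + a + a + b" "r < a + a + b \<or> reads (m + (a + a + b)) (A k @ A k)"
        using 2 f by (simp_all add: r_def)
      show "reads m (A k @ B k @ A k @ A k)"
        using 2(3) by (simp add: reads_append)
    qed
  qed
  \<comment> \<open>Beyond \<open>AB\<close> the offset lies in the third or fourth factor, an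
    \<open>A\<close> that is followed by an \<open>A\<close>.\<close>
  have "s (n + a) = s n" if "a + b \<le> r"
  proof (cases "r < a + a + b")
    case True
    have "s (m + (a + b) + (r - (a + b)) + a) = s (m + (a + b) + (r - (a + b)))"
      by (rule reads_eq[where w = "A k"])
        (use m(3) that True in \<open>simp_all add: reads_append len ac_simps\<close>)
    then show ?thesis using m(1) that by simp
  next
    case False
    then have "reads (m + (a + a + b)) (A k @ A k)" using m(4) by simp
    then have "s (m + (a + a + b) + (r - (a + a + b)) + a) = s (m + (a + a + b) + (r - (a + a + b)))"
      by (intro reads_eq[where w = "A k"])
        (use m(2) False in \<open>simp_all add: reads_append len ac_simps\<close>)
    then show ?thesis using m(1) False by simp
  qed
  moreover have "s (n + a) \<noteq> s n \<longleftrightarrow> r \<in> {(a + b) div 2, (a + b) div 2 - 1}" if "r < a + b"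
  proof -
    have "s (m + r + a) \<noteq> s (m + r) \<longleftrightarrow> (A k @ B k) ! r \<noteq> (B k @ A k) ! r"
      by (rule reads_neq_iff) (use m(3) that in \<open>simp_all add: reads_append len ac_simps\<close>)
    then show ?thesis
      using AB_neq_BA_iff[of r k] that m(1) unfolding f by simp
  qed
  moreover have "r \<notin> {(a + b) div 2, (a + b) div 2 - 1}" if "a + b \<le> r"
    using that f_odd_ge[of k] unfolding f by auto
  ultimately show ?thesis
    unfolding f r_def[symmetric] by (meson not_less)
qed

lemma shift_f_odd:
  assumes "1 \<le> k"
  shows "s (n + f (2 * k + 1)) \<noteq> s n \<longleftrightarrow>
    Phi k n \<in> {f (2 * k + 3) div 2, f (2 * k + 3) div 2 - 1,
               f (2 * k + 3) div 2 + f (2 * k), f (2 * k + 3) div 2 + f (2 * k) - 1}"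
proof -
  define a b r where "a = length (A k)" and "b = length (B k)" and "r = Phi k n"
  have f: "f (2 * k) = a" "f (2 * k + 1) = a + b" "f (2 * k + 2) = a + a + b"
    "f (2 * k + 3) = a + a + a + b"
    using length_A[of k] length_AB[of k] f_even_rec[of k] f_odd_rec[of k]
    by (simp_all add: a_def b_def)
  have len: "length (A k) = a" "length (B k) = b"
    by (simp_all add: a_def b_def)
  obtain h where h: "a + b = 2 * h"
    using even_f_odd[of k] unfolding f by blast
  have ineq: "1 \<le> h" "h < a"
    using f_odd_ge[of k] f_odd_less_double[OF assms] h unfolding f by linarith+
  have half: "f (2 * k + 1) div 2 = h" "f (2 * k + 3) div 2 = a + h"
    using f_odd_Suc_half[of k] unfolding f h by simp_all
  \<comment> \<open>An offset in the first \<open>A\<close> is moved into the second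
    \<open>A\<close> of \<open>ABA\<close>, at the same place.\<close>
  have small: "s (n + (a + b)) = s n" if "n = m + r" "r < a" "reads m (A k @ B k @ A k)" for m
  proof -
    have "s (m + r + (a + b)) = s (m + r)"
      by (rule reads_eq[where w = "A k"])
        (use that in \<open>simp_all add: reads_append len ac_simps\<close>)
    then show ?thesis using that(1) by simp
  qed
  have "s (n + (a + b)) \<noteq> s n \<longleftrightarrow> r \<in> {a + h, a + h - 1, a + h + a, a + h + a - 1}"
  proof (cases "r < a")
    case True
    have "s (n + (a + b)) = s n"
    proof (cases n k rule: Phi_block)
      case (1 m)
      have "reads m (A k @ B k @ A k)"
        using 1(3) by (simp add: reads_append)
      then show ?thesis
        using small[of m] True 1(1) by (simp add: r_def)
    next
      case (2 m)
      have "reads m (A k @ B k @ A k)"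
        using 2(3) by (simp add: reads_append)
      then show ?thesis
        using small[of m] True 2(1) by (simp add: r_def)
    qed
    moreover have "r \<notin> {a + h, a + h - 1, a + h + a, a + h + a - 1}"
      using True ineq by auto
    ultimately show ?thesis by simp
  next
    case False
    then obtain i where i: "r = a + i"
      using le_Suc_ex not_less by blast
    have i_iff: "r \<in> {a + h, a + h - 1, a + h + a, a + h + a - 1} \<longleftrightarrow>
        i \<in> {h, h - 1, a + h, a + h - 1}"
      using ineq unfolding i by auto
    show ?thesis
    proof (cases n k rule: Phi_block)
      case (1 m)
      have "i < a + (a + b)"
        using 1(2) i unfolding f r_def by simp
      have "s (m + a + i + (a + b)) \<noteq> s (m + a + i) \<longleftrightarrow>
          (B k @ A k @ A k) ! i \<noteq> (A k @ A k @ B k) ! i"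
        by (rule reads_neq_iff)
          (use 1(3) \<open>i < a + (a + b)\<close> in \<open>simp_all add: reads_append len ac_simps\<close>)
      also have "\<dots> \<longleftrightarrow> i \<in> {h, h - 1, a + h, a + h - 1}"
        by (rule BAA_neq_AAB_iff[OF assms, of i, unfolded half, unfolded f,
              OF \<open>i < a + (a + b)\<close>])
      finally have iff: "s (m + a + i + (a + b)) \<noteq> s (m + a + i) \<longleftrightarrow> \<dots>" .
      have n: "n = m + a + i"
        using 1(1) i by (simp add: r_def)
      show ?thesis
        unfolding i_iff unfolding n by (rule iff)
    next
      case (2 m)
      have "i < a + b"
        using 2(2) i unfolding f r_def by simp
      have "s (m + a + i + (a + b)) \<noteq> s (m + a + i) \<longleftrightarrow> (B k @ A k) ! i \<noteq> (A k @ B k) ! i"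
        by (rule reads_neq_iff)
          (use 2(3) \<open>i < a + b\<close> in \<open>simp_all add: reads_append len ac_simps\<close>)
      also have "\<dots> \<longleftrightarrow> (A k @ B k) ! i \<noteq> (B k @ A k) ! i"
        by (simp only: eq_commute[of "(B k @ A k) ! i" "(A k @ B k) ! i"])
      also have "\<dots> \<longleftrightarrow> i \<in> {h, h - 1}"
        by (rule AB_neq_BA_iff[of i k, unfolded half, unfolded f, OF \<open>i < a + b\<close>])
      \<comment> \<open>In a short block the second pair is out of reach:
        \<open>i < a + b = 2h\<close>, and \<open>2h\<close> is at most \<open>a + h - 1\<close>
        because \<open>h < a\<close>.\<close>
      also have "\<dots> \<longleftrightarrow> i \<in> {h, h - 1, a + h, a + h - 1}"
        using \<open>i < a + b\<close> h ineq by auto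
      finally have iff: "s (m + a + i + (a + b)) \<noteq> s (m + a + i) \<longleftrightarrow> \<dots>" .
      have n: "n = m + a + i"
        using 2(1) i by (simp add: r_def)
      show ?thesis
        unfolding i_iff unfolding n by (rule iff)
    qed
  qed
  then show ?thesis
    unfolding half unfolding f r_def .
qed

theorem theorem4:
  fixes n :: nat
  shows "(\<forall>k. s (n + f (2 * k)) \<noteq> s n \<longleftrightarrow>
             Phi k n \<in> {f (2 * k + 1) div 2, f (2 * k + 1) div 2 - 1}) \<and>
         (\<forall>k\<ge>1. s (n + f (2 * k + 1)) \<noteq> s n \<longleftrightarrow>
             Phi k n \<in> {f (2 * k + 3) div 2, f (2 * k + 3) div 2 - 1,
                        f (2 * k + 3) div 2 + f (2 * k), f (2 * k + 3) div 2 + f (2 * k) - 1})"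
proof (intro conjI allI impI)
  fix k
  show "s (n + f (2 * k)) \<noteq> s n \<longleftrightarrow>
      Phi k n \<in> {f (2 * k + 1) div 2, f (2 * k + 1) div 2 - 1}"
    by (rule shift_f_even)
next
  fix k :: nat
  assume "1 \<le> k"
  then show "s (n + f (2 * k + 1)) \<noteq> s n \<longleftrightarrow>
      Phi k n \<in> {f (2 * k + 3) div 2, f (2 * k + 3) div 2 - 1,
                 f (2 * k + 3) div 2 + f (2 * k), f (2 * k + 3) div 2 + f (2 * k) - 1}"
    by (rule shift_f_odd)
qed

end
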